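(* Let $R$ be a (not necessarily commutative) unital associative algebra, let $n \ge 1$, and let $x_1, \dots, x_n, z \in R$ be such that the Vandermonde matrix $$W=\begin{pmatrix} x_1^{n-1} & \cdots & x_n^{n-1} \\ \vdots & & \vdots \\ x_1 & \cdots & x_n \\ 1 & \cdots & 1\end{pmatrix}\in M(n,R)$$ is invertible over $R$. For each integer $m \ge 0$ let $V_m$ be the quasideterminant, at the position of the entry $z^m$ (position $(1,n+1)$), of the $(n+1)\times(n+1)$ matrix $$\begin{pmatrix} x_1^{m} & \cdots & x_n^{m} & z^{m} \\ x_1^{n-1} & \cdots & x_n^{n-1} & z^{n-1} \\ \vdots & & \vdots & \vdots \\ 1 & \cdots & 1 & 1\end{pmatrix},$$ that is, $$V_m = z^m - \begin{pmatrix} x_1^m & \cdots & x_n^m\end{pmatrix} W^{-1} \begin{pmatrix} z^{n-1} \\ \vdots \\ z \\ 1 \end{pmatrix}.$$ If the Vandermonde quasideterminant $V(x_1,\dots,x_n,z)$ vanishes, i.e. $V_n = 0$, then $V_m = 0$ for all $m = 0, 1, 2, \dots$.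
   Context: For $A=(a_{rs}) \in M(N,R)$ and a position $(i,j)$ such that the matrix $A^{ij}$ obtained by deleting row $i$ and column $j$ is invertible over $R$, the $(i,j)$-quasideterminant is $|A|_{ij} = a_{ij} - r_i^{\,j}\,(A^{ij})^{-1}\, c_j^{\,i}$, where $r_i^{\,j}$ is the $i$-th row of $A$ with the entry $a_{ij}$ removed and $c_j^{\,i}$ is the $j$-th column of $A$ with the entry $a_{ij}$ removed. The Vandermonde quasideterminant $V(x_1,\dots,x_n,z)$ is the $(1,n+1)$-quasideterminant of the $(n+1)\times(n+1)$ matrix whose columns are $(x_1^n,x_1^{n-1},\dots,x_1,1)^T,\dots,(x_n^n,\dots,x_n,1)^T,(z^n,\dots,z,1)^T$. By convention $x^0=1$. *)

theory Defs
  imports "Jordan_Normal_Form.Determinant"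
begin

text \<open>
  Rings are not assumed commutative. Unital rings are exactly the unital associative algebras
  over the integers; an algebra over any other base is in particular such a ring, and the scalars
  play no role below.
\<close>

text \<open>
  \<open>mat_inverse\<close> of the library requires a field. The following is the two-sided inverse over an
  arbitrary unital ring; it is meaningful only under \<^const>\<open>invertible_mat\<close>.
\<close>

definition matrix_inverse :: "'a :: semiring_1 mat \<Rightarrow> 'a mat" where
  "matrix_inverse A = (THE B. inverts_mat A B \<and> inverts_mat B A)"

lemma matrix_inverse_unique:
  assumes "square_mat A" "inverts_mat A B" "inverts_mat B A"
  shows "matrix_inverse A = B"
proof -
  define n where "n = dim_row A"
  have carrier: "C \<in> carrier_mat n n" if "inverts_mat A C" "inverts_mat C A" for C
  proof
    have "dim_col (A * C) = dim_col (1\<^sub>m n :: 'a mat)"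
      using that(1) by (simp only: inverts_mat_def n_def)
    then show "dim_col C = n" by simp
    have "dim_col (C * A) = dim_col (1\<^sub>m (dim_row C) :: 'a mat)"
      using that(2) by (simp only: inverts_mat_def)
    then show "dim_row C = n" using assms(1) by (simp add: n_def)
  qed
  have A: "A \<in> carrier_mat n n" using assms(1) by (auto simp: n_def)
  have "C = B" if C: "inverts_mat A C" "inverts_mat C A" for C
  proof -
    have B': "B \<in> carrier_mat n n" and C': "C \<in> carrier_mat n n"
      using assms(2,3) C by (auto intro: carrier)
    have AB: "A * B = 1\<^sub>m n" and CA: "C * A = 1\<^sub>m n"
      using assms(2) C(2) C' by (simp_all add: inverts_mat_def n_def)
    have "C = C * (A * B)" unfolding AB using C' by (rule right_mult_one_mat[symmetric])
    also have "\<dots> = (C * A) * B" by (rule assoc_mult_mat[OF C' A B', symmetric])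
    also have "\<dots> = B" unfolding CA using B' by (rule left_mult_one_mat)
    finally show ?thesis .
  qed
  then show ?thesis
    unfolding matrix_inverse_def using assms(2,3) by (intro the_equality) blast+
qed

text \<open>
  Row and column indices start at 0, as in the library, so position \<open>(1,n+1)\<close> is \<open>(0,n)\<close> here.
\<close>

definition row_delete :: "'a mat \<Rightarrow> nat \<Rightarrow> nat \<Rightarrow> 'a vec" where
  "row_delete A i j = vec (dim_col A - 1) (\<lambda>k. A $$ (i, insert_index j k))"

definition col_delete :: "'a mat \<Rightarrow> nat \<Rightarrow> nat \<Rightarrow> 'a vec" where
  "col_delete A i j = vec (dim_row A - 1) (\<lambda>k. A $$ (insert_index i k, j))"

definition quasideterminant :: "'a :: ring_1 mat \<Rightarrow> nat \<Rightarrow> nat \<Rightarrow> 'a" where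
  "quasideterminant A i j =
     A $$ (i, j) - row_delete A i j \<bullet> (matrix_inverse (mat_delete A i j) *\<^sub>v col_delete A i j)"

text \<open>The variables \<open>x\<^sub>1, \<dots>, x\<^sub>n\<close> are \<open>x 0, \<dots>, x (n - 1)\<close>.\<close>

definition vandermonde_mat :: "nat \<Rightarrow> (nat \<Rightarrow> 'a :: ring_1) \<Rightarrow> 'a mat" where
  "vandermonde_mat n x = mat n n (\<lambda>(i, j). x j ^ (n - 1 - i))"

definition vandermonde_quasidet :: "nat \<Rightarrow> (nat \<Rightarrow> 'a :: ring_1) \<Rightarrow> 'a \<Rightarrow> 'a" where
  "vandermonde_quasidet n x z = quasideterminant (vandermonde_mat (Suc n) (x(n := z))) 0 n"

text \<open>The Vandermonde matrix of \<open>x\<^sub>1, \<dots>, x\<^sub>n, z\<close> with the exponent in its top row replaced by \<open>m\<close>.\<close>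

definition power_mat :: "nat \<Rightarrow> nat \<Rightarrow> (nat \<Rightarrow> 'a :: ring_1) \<Rightarrow> 'a \<Rightarrow> 'a mat" where
  "power_mat m n x z =
     mat (Suc n) (Suc n) (\<lambda>(i, j). (x(n := z)) j ^ (if i = 0 then m else n - i))"

definition power_quasidet :: "nat \<Rightarrow> nat \<Rightarrow> (nat \<Rightarrow> 'a :: ring_1) \<Rightarrow> 'a \<Rightarrow> 'a" where
  "power_quasidet m n x z = quasideterminant (power_mat m n x z) 0 n"

lemma power_quasidet_self: "power_quasidet n n x z = vandermonde_quasidet n x z"
proof -
  have "power_mat n n x z = vandermonde_mat (Suc n) (x(n := z))"
    unfolding power_mat_def vandermonde_mat_def by (intro eq_matI) auto
  then show ?thesis by (simp add: power_quasidet_def vandermonde_quasidet_def)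
qed

lemma power_quasidet_eq:
  "power_quasidet m n x z =
     z ^ m - vec n (\<lambda>j. x j ^ m) \<bullet>
       (matrix_inverse (vandermonde_mat n x) *\<^sub>v vec n (\<lambda>i. z ^ (n - 1 - i)))"
proof -
  have "mat_delete (power_mat m n x z) 0 n = vandermonde_mat n x"
    unfolding power_mat_def vandermonde_mat_def mat_delete_def by (intro eq_matI) auto
  moreover have "row_delete (power_mat m n x z) 0 n = vec n (\<lambda>j. x j ^ m)"
    unfolding power_mat_def row_delete_def by (intro eq_vecI) auto
  moreover have "col_delete (power_mat m n x z) 0 n = vec n (\<lambda>i. z ^ (n - 1 - i))"
    unfolding power_mat_def col_delete_def by (intro eq_vecI) auto
  moreover have "power_mat m n x z $$ (0, n) = z ^ m"
    by (simp add: power_mat_def)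
  ultimately show ?thesis by (simp add: power_quasidet_def quasideterminant_def)
qed

end

theory Submission
  imports Defs
begin

text \<open>
  If \<open>V\<^sub>n = 0\<close>, the row vector \<open>(x\<^sub>1\<^sup>n, \<dots>, x\<^sub>n\<^sup>n) W\<^sup>-\<^sup>1\<close> holds the coefficients of a monic
  polynomial of degree \<open>n\<close>, with coefficients written on the left, that vanishes at \<open>x\<^sub>1, \<dots>, x\<^sub>n\<close>
  and at \<open>z\<close>. Multiplication on the right by the variable then shows that \<open>y\<^sup>m\<close> is, for \<open>y\<close> among
  these \<open>n + 1\<close> elements, a left linear combination of \<open>1, y, \<dots>, y\<^sup>n\<^sup>-\<^sup>1\<close> with coefficients not
  depending on \<open>y\<close>. Hence the top row of the matrix defining \<open>V\<^sub>m\<close> is a left combination of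
  the other rows, and \<open>V\<^sub>m\<close> vanishes.
\<close>

lemma powers_common_left_combination:
  fixes a :: "nat \<Rightarrow> 'a :: semiring_1"
  assumes "0 < n" and a: "\<And>y. y \<in> S \<Longrightarrow> y ^ n = (\<Sum>k<n. a k * y ^ k)"
  shows "\<exists>b. \<forall>y\<in>S. y ^ m = (\<Sum>k<n. b k * y ^ k)"
proof (induction m)
  case 0
  have "y ^ 0 = (\<Sum>k<n. (if k = 0 then 1 else 0) * y ^ k)" for y :: 'a
    using \<open>0 < n\<close> by (simp add: if_distrib[of "\<lambda>c. c * _"] cong: if_cong)
  then show ?case by (intro exI[of _ "\<lambda>k. if k = 0 then 1 else 0"]) blast
next
  case (Suc m)
  then obtain b where b: "\<And>y. y \<in> S \<Longrightarrow> y ^ m = (\<Sum>k<n. b k * y ^ k)" by blast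
  obtain p where n: "n = Suc p" using \<open>0 < n\<close> gr0_implies_Suc by blast
  \<comment> \<open>Right multiplication by \<open>y\<close> shifts the coefficients up by one; the
    overflow \<open>b p * y ^ n\<close> is expanded through \<open>a\<close>, its left factor
    staying on the left.\<close>
  define c where "c k = (case k of 0 \<Rightarrow> 0 | Suc i \<Rightarrow> b i) + b p * a k" for k
  have "y ^ Suc m = (\<Sum>k<n. c k * y ^ k)" if "y \<in> S" for y
  proof -
    have "y ^ Suc m = (\<Sum>k<n. b k * y ^ k) * y"
      by (simp only: power_Suc2 b[OF that])
    also have "\<dots> = (\<Sum>k<p. b k * y ^ Suc k) + b p * y ^ n"
      by (simp add: n sum_distrib_right mult.assoc power_Suc2 distrib_right del: power_Suc)
    also have "(\<Sum>k<p. b k * y ^ Suc k) = (\<Sum>k<n. (case k of 0 \<Rightarrow> 0 | Suc i \<Rightarrow> b i) * y ^ k)"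
      unfolding n by (subst sum.lessThan_Suc_shift) simp
    also have "b p * y ^ n = (\<Sum>k<n. b p * a k * y ^ k)"
      by (simp only: a[OF that] sum_distrib_left mult.assoc)
    finally show ?thesis by (simp only: c_def distrib_right sum.distrib)
  qed
  then show ?case by blast
qed

text \<open>Associativity of row times matrix times column: the two sums are swapped while the order
  of the factors is kept.\<close>

lemma scalar_prod_mult_mat_vec:
  fixes A :: "'a :: semiring_0 mat"
  assumes "A \<in> carrier_mat m n" "v \<in> carrier_vec n"
  shows "vec m b \<bullet> (A *\<^sub>v v) = vec n (\<lambda>l. \<Sum>k<m. b k * A $$ (k, l)) \<bullet> v"
proof -
  have "vec m b \<bullet> (A *\<^sub>v v) = (\<Sum>k<m. \<Sum>l<n. b k * A $$ (k, l) * v $ l)"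
    using assms by (auto simp: scalar_prod_def sum_distrib_left mult.assoc atLeast0LessThan
        intro!: sum.cong)
  also have "\<dots> = (\<Sum>l<n. \<Sum>k<m. b k * A $$ (k, l) * v $ l)"
    by (rule sum.swap)
  also have "\<dots> = vec n (\<lambda>l. \<Sum>k<m. b k * A $$ (k, l)) \<bullet> v"
    using assms by (auto simp: scalar_prod_def sum_distrib_right atLeast0LessThan
        intro!: sum.cong)
  finally show ?thesis .
qed

lemma invertible_mat_matrix_inverse:
  fixes A :: "'a :: semiring_1 mat"
  assumes A: "A \<in> carrier_mat n n" and "invertible_mat A"
  shows "matrix_inverse A \<in> carrier_mat n n"
    and "A * matrix_inverse A = 1\<^sub>m n" and "matrix_inverse A * A = 1\<^sub>m n"
proof -
  obtain B where "square_mat A" and B: "inverts_mat A B" "inverts_mat B A"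
    using assms(2) by (auto simp: invertible_mat_def)
  then have inv: "matrix_inverse A = B" by (rule matrix_inverse_unique)
  have AB: "A * B = 1\<^sub>m n" and BA: "B * A = 1\<^sub>m (dim_row B)"
    using A B by (simp_all add: inverts_mat_def)
  \<comment> \<open>\<open>inverts_mat\<close> does not fix the size of \<open>B\<close>; it is read
    off from the two identity matrices.\<close>
  have "dim_row B = n" using A arg_cong[OF BA, of dim_col] by simp
  moreover have "dim_col B = n" using arg_cong[OF AB, of dim_col] by simp
  ultimately show "matrix_inverse A \<in> carrier_mat n n"
    "A * matrix_inverse A = 1\<^sub>m n" "matrix_inverse A * A = 1\<^sub>m n"
    using AB BA by (auto simp: inv)
qed

text \<open>Row \<open>k\<close> carries the exponent \<open>n - 1 - k\<close>, so reversing the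
  coefficients makes \<open>b k\<close> belong to the \<open>k\<close>-th power.\<close>

lemma vandermonde_mat_left_combination:
  "l < n \<Longrightarrow> (\<Sum>k<n. b (n - 1 - k) * vandermonde_mat n x $$ (k, l)) = (\<Sum>k<n. b k * x l ^ k)"
  unfolding sum.nat_diff_reindex[of "\<lambda>k. b k * x l ^ k", symmetric]
  by (auto simp: vandermonde_mat_def intro!: sum.cong)

text \<open>With \<open>W\<close> the Vandermonde matrix and \<open>u\<close> the row of the
  \<open>x l ^ m\<close>, the row \<open>u\<close> times the inverse of \<open>W\<close> is the only
  row \<open>r\<close> whose product with \<open>W\<close> is \<open>u\<close>. The quasideterminant
  vanishes exactly when this \<open>r\<close> also produces \<open>z ^ m\<close> from the lower
  powers of \<open>z\<close>.\<close>

lemma power_quasidet_eq_0_iff: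
  fixes x :: "nat \<Rightarrow> 'a :: ring_1"
  assumes inv: "invertible_mat (vandermonde_mat n x)"
  shows "power_quasidet m n x z = 0 \<longleftrightarrow>
    (\<exists>b. \<forall>y\<in>insert z (x ` {..<n}). y ^ m = (\<Sum>k<n. b k * y ^ k))"
proof -
  define W where "W = vandermonde_mat n x"
  define B where "B = matrix_inverse W"
  define u where "u = vec n (\<lambda>l. x l ^ m)"
  define w where "w = vec n (\<lambda>k. z ^ (n - 1 - k))"
  have W: "W \<in> carrier_mat n n" by (simp add: W_def vandermonde_mat_def)
  have B: "B \<in> carrier_mat n n" and WB: "W * B = 1\<^sub>m n" and BW: "B * W = 1\<^sub>m n"
    using invertible_mat_matrix_inverse[OF W] inv by (simp_all add: W_def B_def)
  have w: "w \<in> carrier_vec n" by (simp add: w_def)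
  have V: "power_quasidet m n x z = z ^ m - u \<bullet> (B *\<^sub>v w)"
    by (simp add: power_quasidet_eq W_def B_def u_def w_def)
  have rev: "vec n (\<lambda>k. b (n - 1 - k)) \<bullet> w = (\<Sum>k<n. b k * z ^ k)" for b
    by (subst sum.nat_diff_reindex[symmetric])
      (auto simp: w_def scalar_prod_def atLeast0LessThan intro!: sum.cong)
  show ?thesis
  proof
    assume "power_quasidet m n x z = 0"
    then have z: "z ^ m = u \<bullet> (B *\<^sub>v w)" using V by simp
    \<comment> \<open>\<open>a\<close> is the row \<open>u\<close> times \<open>B\<close>;
      \<open>b\<close> lists it by increasing exponent.\<close>
    define a where "a k = (\<Sum>i<n. x i ^ m * B $$ (i, k))" for k
    define b where "b k = a (n - 1 - k)" for k
    have a: "u \<bullet> (B *\<^sub>v v) = vec n (\<lambda>k. b (n - 1 - k)) \<bullet> v" if "v \<in> carrier_vec n" for v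
    proof -
      have "u \<bullet> (B *\<^sub>v v) = vec n a \<bullet> v"
        unfolding u_def a_def by (rule scalar_prod_mult_mat_vec[OF B that])
      also have "vec n a = vec n (\<lambda>k. b (n - 1 - k))" by (auto simp: b_def)
      finally show ?thesis .
    qed
    have "x l ^ m = (\<Sum>k<n. b k * x l ^ k)" if l: "l < n" for l
    proof -
      have "B *\<^sub>v col W l = unit_vec n l"
        using col_mult2[OF B W l] BW l by simp
      then have "x l ^ m = u \<bullet> (B *\<^sub>v col W l)" using l by (simp add: u_def)
      also have "\<dots> = vec n (\<lambda>k. b (n - 1 - k)) \<bullet> col W l" using W by (intro a) auto
      also have "\<dots> = (\<Sum>k<n. b (n - 1 - k) * W $$ (k, l))"
        using W l by (auto simp: scalar_prod_def atLeast0LessThan intro!: sum.cong)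
      also have "\<dots> = (\<Sum>k<n. b k * x l ^ k)"
        unfolding W_def by (rule vandermonde_mat_left_combination[OF l])
      finally show ?thesis .
    qed
    moreover have "z ^ m = (\<Sum>k<n. b k * z ^ k)" using z a[OF w] rev by simp
    ultimately show "\<exists>b. \<forall>y\<in>insert z (x ` {..<n}). y ^ m = (\<Sum>k<n. b k * y ^ k)"
      by (intro exI[of _ b]) auto
  next
    assume "\<exists>b. \<forall>y\<in>insert z (x ` {..<n}). y ^ m = (\<Sum>k<n. b k * y ^ k)"
    then obtain b where z: "z ^ m = (\<Sum>k<n. b k * z ^ k)"
      and x: "\<And>l. l < n \<Longrightarrow> x l ^ m = (\<Sum>k<n. b k * x l ^ k)" by auto
    have "u = vec n (\<lambda>l. \<Sum>k<n. b (n - 1 - k) * W $$ (k, l))"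
      unfolding u_def W_def by (intro eq_vecI) (simp_all only: x vandermonde_mat_left_combination
          dim_vec index_vec)
    \<comment> \<open>Once \<open>u\<close> is written as a row times \<open>W\<close>, the product
      \<open>W * B\<close> cancels.\<close>
    then have "u \<bullet> (B *\<^sub>v w) = vec n (\<lambda>k. b (n - 1 - k)) \<bullet> (W *\<^sub>v (B *\<^sub>v w))"
      using scalar_prod_mult_mat_vec[OF W mult_mat_vec_carrier[OF B w]] by simp
    also have "W *\<^sub>v (B *\<^sub>v w) = w"
      using assoc_mult_mat_vec[OF W B w] WB w by simp
    finally show "power_quasidet m n x z = 0" using V z rev by simp
  qed
qed

theorem theorem10:
  fixes x :: "nat \<Rightarrow> 'a :: ring_1" and z :: 'a and n :: nat
  assumes "n \<ge> 1"
    and "invertible_mat (vandermonde_mat n x)"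
    and "vandermonde_quasidet n x z = 0"
  shows "\<forall>m. power_quasidet m n x z = 0"
proof -
  have "power_quasidet n n x z = 0"
    using assms(3) by (simp add: power_quasidet_self)
  \<comment> \<open>The equivalence is read forwards at exponent \<open>n\<close> and backwards at
    every \<open>m\<close>.\<close>
  then obtain a where "\<And>y. y \<in> insert z (x ` {..<n}) \<Longrightarrow> y ^ n = (\<Sum>k<n. a k * y ^ k)"
    unfolding power_quasidet_eq_0_iff[OF assms(2)] by blast
  then show ?thesis
    unfolding power_quasidet_eq_0_iff[OF assms(2)]
    by (intro allI powers_common_left_combination) (use assms(1) in auto)
qed

end
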